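(* Let $\Omega\subset\mathbb{R}^n$ be a real algebraic curve that is a closed parametric $C^1$ curve with a given parameterization $X:[a,b]\to\Omega$ such that $X'(t)\ne0$ for all $t\in[a,b]$, let $g(t)=\|X'(t)\|^2$, and let $u$ be the solution of $-\Delta u+c\cdot u=f$ on $\Omega$, where $\Delta$ is the Laplace-Beltrami operator on $\Omega$; that is, writing $u,c,f$ also for the corresponding functions of $t\in[a,b]$, $u$ is periodic on $[a,b]$ and $$-\frac1g\frac{d^2u}{dt^2}+\frac1{2g^2}\frac{dg}{dt}\frac{du}{dt}+c\cdot u=f\quad\text{on }[a,b].$$ If $u\in C^4(\Omega)$ and there exists $\delta>0$ such that $c>\delta$, then the numerical scheme $A_NU_N=F_N$ defined in the context is convergent, stable, and has second order accuracy.
   Context: A real algebraic curve $\Omega\subset\mathbb{R}^n$ is a closed parametric $C^k$ curve if there is a closed interval $[a,b]$ and a surjection $X:[a,b]\to\Omega$ of class $C^k$ with $X^{(r)}(a)=X^{(r)}(b)$ for all $0\le r\le k$ ($X$ need not be injective on $[a,b)$). Functions on $\Omega$ are regarded as functions of the parameter $t\in[a,b]$ with periodic boundary (so at a self-intersection they may take one value per branch). $u\in C^4(\Omega)$ means that $u$, as a function of $t$, is four times continuously differentiable on $[a,b]$, with the periodic boundary understood to mean that its derivatives of order $0,\dots,4$ agree at $a$ and $b$. The coefficients $c,f$ are real-valued functions on $[a,b]$, taking equal values at $a$ and $b$, independent of $u$. The scheme: given $N\ge3$, set $\Delta t=(b-a)/N$ and $t_i=a+i\Delta t$ for $i=0,\dots,N$.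 The unknown is $U_N=(u_0,\dots,u_{N-1})^T$ with $u_i\approx u(t_i)$, and $F_N=(f(t_0),\dots,f(t_{N-1}))^T$. The matrix $A_N$ is the $N\times N$ periodic tridiagonal matrix for which the $i$-th equation of $A_NU_N=F_N$ is $$L_iu_{i-1}+C_iu_i+R_iu_{i+1}=f(t_i),\qquad i=0,\dots,N-1,$$ with indices of $u$ taken modulo $N$ (so $u_{-1}=u_{N-1}$ and $u_N=u_0$), where $$L_i=-\frac1{g(t_i)\Delta t^2}\Bigl(1+\frac{g'(t_i)\Delta t}{4g(t_i)}\Bigr),\quad C_i=c(t_i)+\frac2{g(t_i)\Delta t^2},\quad R_i=-\frac1{g(t_i)\Delta t^2}\Bigl(1-\frac{g'(t_i)\Delta t}{4g(t_i)}\Bigr).$$ Let $u_N=(u(t_0),\dots,u(t_{N-1}))^T$ be the vector of exact values. "Stable" means that for all sufficiently large $N$ the matrix $A_N$ is invertible and $\|A_N^{-1}\|_\infty$ is bounded uniformly in $N$. "Convergent" means $\|u_N-U_N\|_\infty\to0$ as $N\to\infty$. "Second order accuracy" means there is a constant $K$ independent of $N$ with $\|u_N-U_N\|_\infty\le K\,\Delta t^2$ for all sufficiently large $N$.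
   Formalization: The formal theorem additionally assumes that g is differentiable on [a,b] with bounded derivative; for X merely C^1, dg/dt need not exist, and for differentiable g with unbounded dg/dt the matrices A_N can be singular for infinitely many N. *)

theory Defs
  imports "HOL-Analysis.Analysis" "HOL-Library.Extended_Nat" "Jordan_Normal_Form.Matrix"
begin

(* vec, mat and $ exist both in HOL-Analysis (fixed finite dimension) and in
   Jordan_Normal_Form.Matrix (dimension stored in the object).  The ambient space of the curve
   uses the former, the N-dependent linear systems use the latter. *)

section \<open>Real algebraic curves\<close>

definition real_algebraic_set :: "'a::euclidean_space set \<Rightarrow> bool" where
  "real_algebraic_set V \<longleftrightarrow>
     (\<exists>P. (\<forall>p\<in>P. real_polynomial_function p) \<and> V = {x. \<forall>p\<in>P. p x = 0})"

definition irreducible_algebraic_set :: "'a::euclidean_space set \<Rightarrow> bool" where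
  "irreducible_algebraic_set V \<longleftrightarrow> real_algebraic_set V \<and> V \<noteq> {} \<and>
     (\<forall>V1 V2. real_algebraic_set V1 \<longrightarrow> real_algebraic_set V2 \<longrightarrow> V = V1 \<union> V2 \<longrightarrow>
        V1 = V \<or> V2 = V)"

(* Krull dimension in the real Zariski topology; the empty set gets dimension 0. *)
definition algebraic_dim :: "'a::euclidean_space set \<Rightarrow> enat" where
  "algebraic_dim V =
     Sup {enat d | d. \<exists>Z :: nat \<Rightarrow> 'a set.
            (\<forall>i\<le>d. irreducible_algebraic_set (Z i) \<and> Z i \<subseteq> V) \<and> (\<forall>i<d. Z i \<subset> Z (Suc i))}"

definition real_algebraic_curve :: "'a::euclidean_space set \<Rightarrow> bool" where
  "real_algebraic_curve V \<longleftrightarrow> real_algebraic_set V \<and> algebraic_dim V = 1"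

section \<open>Closed parametric curves and periodic functions\<close>

(* Derivative on [a,b], one-sided at the endpoints. *)
definition pderiv_on :: "real \<Rightarrow> real \<Rightarrow> (real \<Rightarrow> 'a::real_normed_vector) \<Rightarrow> real \<Rightarrow> 'a" where
  "pderiv_on a b h t = vector_derivative h (at t within {a..b})"

definition iter_pderiv_on ::
    "real \<Rightarrow> real \<Rightarrow> nat \<Rightarrow> (real \<Rightarrow> 'a::real_normed_vector) \<Rightarrow> real \<Rightarrow> 'a" where
  "iter_pderiv_on a b r h = (pderiv_on a b ^^ r) h"

definition Ck_on :: "nat \<Rightarrow> real \<Rightarrow> real \<Rightarrow> (real \<Rightarrow> 'a::real_normed_vector) \<Rightarrow> bool" where
  "Ck_on k a b h \<longleftrightarrow>
     (\<forall>r<k. iter_pderiv_on a b r h differentiable_on {a..b}) \<and>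
     continuous_on {a..b} (iter_pderiv_on a b k h)"

definition periodic_Ck :: "nat \<Rightarrow> real \<Rightarrow> real \<Rightarrow> (real \<Rightarrow> 'a::real_normed_vector) \<Rightarrow> bool" where
  "periodic_Ck k a b h \<longleftrightarrow>
     Ck_on k a b h \<and> (\<forall>r\<le>k. iter_pderiv_on a b r h a = iter_pderiv_on a b r h b)"

definition closed_Ck_parametrization ::
    "nat \<Rightarrow> real \<Rightarrow> real \<Rightarrow> (real \<Rightarrow> 'a::real_normed_vector) \<Rightarrow> 'a set \<Rightarrow> bool" where
  "closed_Ck_parametrization k a b X \<Omega> \<longleftrightarrow> a < b \<and> X ` {a..b} = \<Omega> \<and> periodic_Ck k a b X"

definition metric_coeff :: "real \<Rightarrow> real \<Rightarrow> (real \<Rightarrow> 'a::real_normed_vector) \<Rightarrow> real \<Rightarrow> real" where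
  "metric_coeff a b X t = (norm (pderiv_on a b X t))\<^sup>2"

(* Expanded form of g^(-1/2) d/dt (g^(-1/2) du/dt), where g is the metric in the parameter t. *)
definition laplace_beltrami ::
    "real \<Rightarrow> real \<Rightarrow> (real \<Rightarrow> real) \<Rightarrow> (real \<Rightarrow> real) \<Rightarrow> real \<Rightarrow> real" where
  "laplace_beltrami a b g u t =
     1 / g t * iter_pderiv_on a b 2 u t
     - 1 / (2 * (g t)\<^sup>2) * pderiv_on a b g t * pderiv_on a b u t"

section \<open>The finite difference scheme\<close>

definition step :: "real \<Rightarrow> real \<Rightarrow> nat \<Rightarrow> real" where
  "step a b N = (b - a) / real N"

definition node :: "real \<Rightarrow> real \<Rightarrow> nat \<Rightarrow> nat \<Rightarrow> real" where
  "node a b N i = a + real i * step a b N"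

definition coeff_L :: "real \<Rightarrow> real \<Rightarrow> (real \<Rightarrow> real) \<Rightarrow> nat \<Rightarrow> nat \<Rightarrow> real" where
  "coeff_L a b g N i = (let h = step a b N; t = node a b N i in
     - (1 / (g t * h\<^sup>2)) * (1 + pderiv_on a b g t * h / (4 * g t)))"

definition coeff_C ::
    "real \<Rightarrow> real \<Rightarrow> (real \<Rightarrow> real) \<Rightarrow> (real \<Rightarrow> real) \<Rightarrow> nat \<Rightarrow> nat \<Rightarrow> real" where
  "coeff_C a b g c N i = (let h = step a b N; t = node a b N i in
     c t + 2 / (g t * h\<^sup>2))"

definition coeff_R :: "real \<Rightarrow> real \<Rightarrow> (real \<Rightarrow> real) \<Rightarrow> nat \<Rightarrow> nat \<Rightarrow> real" where
  "coeff_R a b g N i = (let h = step a b N; t = node a b N i in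
     - (1 / (g t * h\<^sup>2)) * (1 - pderiv_on a b g t * h / (4 * g t)))"

(* Intended for N >= 3, where the three column indices of a row are distinct. *)
definition scheme_mat ::
    "real \<Rightarrow> real \<Rightarrow> (real \<Rightarrow> real) \<Rightarrow> (real \<Rightarrow> real) \<Rightarrow> nat \<Rightarrow> real Matrix.mat" where
  "scheme_mat a b g c N = Matrix.mat N N (\<lambda>(i, j).
      if j = i then coeff_C a b g c N i
      else if j = (i + N - 1) mod N then coeff_L a b g N i
      else if j = (i + 1) mod N then coeff_R a b g N i
      else 0)"

definition sample_vec :: "real \<Rightarrow> real \<Rightarrow> (real \<Rightarrow> real) \<Rightarrow> nat \<Rightarrow> real Matrix.vec" where
  "sample_vec a b h N = Matrix.vec N (\<lambda>i. h (node a b N i))"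

(* For positive dimension. *)
definition vec_norm_inf :: "real Matrix.vec \<Rightarrow> real" where
  "vec_norm_inf v = Max ((\<lambda>i. \<bar>vec_index v i\<bar>) ` {..<dim_vec v})"

(* Maximal absolute row sum, for positive dimension. *)
definition mat_norm_inf :: "real Matrix.mat \<Rightarrow> real" where
  "mat_norm_inf A = Max ((\<lambda>i. \<Sum>j<dim_col A. \<bar>A $$ (i, j)\<bar>) ` {..<dim_row A})"

definition scheme_stable :: "(nat \<Rightarrow> real Matrix.mat) \<Rightarrow> bool" where
  "scheme_stable A \<longleftrightarrow>
     (\<exists>K. \<forall>\<^sub>F N in sequentially. \<exists>B\<in>carrier_mat N N.
        inverts_mat (A N) B \<and> inverts_mat B (A N) \<and> mat_norm_inf B \<le> K)"

(* U N solves the N-th system; for finitely many N the system may fail to be solvable. *)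
definition scheme_solution ::
    "(nat \<Rightarrow> real Matrix.mat) \<Rightarrow> (nat \<Rightarrow> real Matrix.vec) \<Rightarrow> (nat \<Rightarrow> real Matrix.vec) \<Rightarrow> bool" where
  "scheme_solution A F U \<longleftrightarrow>
     (\<forall>\<^sub>F N in sequentially. U N \<in> carrier_vec N \<and> A N *\<^sub>v U N = F N)"

(* The first conjunct excludes vacuous truth for unsolvable systems. *)
definition scheme_convergent ::
    "(nat \<Rightarrow> real Matrix.mat) \<Rightarrow> (nat \<Rightarrow> real Matrix.vec) \<Rightarrow> (nat \<Rightarrow> real Matrix.vec) \<Rightarrow> bool" where
  "scheme_convergent A F v \<longleftrightarrow>
     (\<exists>U. scheme_solution A F U) \<and>
     (\<forall>U. scheme_solution A F U \<longrightarrow> (\<lambda>N. vec_norm_inf (v N - U N)) \<longlonglongrightarrow> 0)"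

definition scheme_second_order ::
    "(nat \<Rightarrow> real) \<Rightarrow> (nat \<Rightarrow> real Matrix.mat) \<Rightarrow> (nat \<Rightarrow> real Matrix.vec) \<Rightarrow>
      (nat \<Rightarrow> real Matrix.vec) \<Rightarrow> bool" where
  "scheme_second_order h A F v \<longleftrightarrow>
     (\<exists>U. scheme_solution A F U) \<and>
     (\<exists>K. \<forall>U. scheme_solution A F U \<longrightarrow>
        (\<forall>\<^sub>F N in sequentially. vec_norm_inf (v N - U N) \<le> K * (h N)\<^sup>2))"

end

theory Submission
  imports Defs "Jordan_Normal_Form.Determinant" "HOL-Real_Asymp.Real_Asymp"
begin

text \<open>
  For small step size the off-diagonal entries of the scheme matrix are nonpositive and each row
  sums to the value of \<open>c\<close> at the node, so the matrix is strictly diagonally dominant with a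
  margin \<open>\<delta>\<close> that does not depend on \<open>N\<close>. Hence the inverse has norm at most \<open>1 / \<delta>\<close>.
  A Taylor expansion bounds the truncation error by a multiple of the squared step size, and
  stability transfers this bound to the global error. At the node \<open>a\<close> the left neighbour is
  expanded about \<open>b\<close>, where the derivatives of \<open>u\<close> agree with those at \<open>a\<close>.
\<close>

section \<open>Diagonally dominant matrices\<close>

lemma vec_norm_inf_le_iff:
  assumes "dim_vec v > 0"
  shows "vec_norm_inf v \<le> K \<longleftrightarrow> (\<forall>i<dim_vec v. \<bar>vec_index v i\<bar> \<le> K)"
  using assms unfolding vec_norm_inf_def by (subst Max_le_iff) auto

lemma abs_index_le_vec_norm_inf:
  assumes "i < dim_vec v"
  shows "\<bar>vec_index v i\<bar> \<le> vec_norm_inf v"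
  using assms vec_norm_inf_le_iff[of v "vec_norm_inf v"] by auto

lemma vec_norm_inf_attained:
  assumes "dim_vec v > 0"
  obtains i where "i < dim_vec v" "vec_norm_inf v = \<bar>vec_index v i\<bar>"
proof -
  have "vec_norm_inf v \<in> (\<lambda>i. \<bar>vec_index v i\<bar>) ` {..<dim_vec v}"
    unfolding vec_norm_inf_def using assms by (intro Max_in) auto
  then show ?thesis using that by auto
qed

lemma vec_norm_inf_nonneg:
  assumes "dim_vec v > 0"
  shows "0 \<le> vec_norm_inf v"
  using abs_index_le_vec_norm_inf[OF assms] abs_ge_zero order_trans by blast

lemma mat_norm_inf_le_iff:
  assumes "dim_row A > 0"
  shows "mat_norm_inf A \<le> K \<longleftrightarrow> (\<forall>i<dim_row A. (\<Sum>j<dim_col A. \<bar>A $$ (i, j)\<bar>) \<le> K)"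
  using assms unfolding mat_norm_inf_def by (subst Max_le_iff) auto

lemma mult_mat_vec_index:
  assumes "A \<in> carrier_mat n m" "v \<in> carrier_vec m" "i < n"
  shows "vec_index (A *\<^sub>v v) i = (\<Sum>j<m. A $$ (i, j) * vec_index v j)"
  using assms by (simp add: scalar_prod_def lessThan_atLeast0)

text \<open>Look at a row \<open>i\<close> where \<open>v\<close> attains its norm. There the
  off-diagonal part is at most \<open>\<bar>A $$ (i, i)\<bar> - \<delta>\<close> times the norm, so
  it cannot cancel the diagonal term and at least \<open>\<delta>\<close> times the norm
  survives.\<close>

lemma diag_dominant_vec_norm_le:
  fixes A :: "real Matrix.mat"
  assumes A: "A \<in> carrier_mat n n" and v: "v \<in> carrier_vec n" and n: "n > 0"
    and dom: "\<And>i. i < n \<Longrightarrow> \<delta> + (\<Sum>j\<in>{..<n} - {i}. \<bar>A $$ (i, j)\<bar>) \<le> \<bar>A $$ (i, i)\<bar>"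
  shows "\<delta> * vec_norm_inf v \<le> vec_norm_inf (A *\<^sub>v v)"
proof -
  obtain i where i: "i < n" and vi: "vec_norm_inf v = \<bar>vec_index v i\<bar>"
    using vec_norm_inf_attained[of v] v n by auto
  let ?S = "\<Sum>j\<in>{..<n} - {i}. A $$ (i, j) * vec_index v j"
  have split: "vec_index (A *\<^sub>v v) i = A $$ (i, i) * vec_index v i + ?S"
    unfolding mult_mat_vec_index[OF A v i] using i by (subst sum.remove[of _ i]) auto
  have "\<bar>?S\<bar> \<le> (\<Sum>j\<in>{..<n} - {i}. \<bar>A $$ (i, j)\<bar> * vec_norm_inf v)"
    using v by (intro order_trans[OF sum_abs] sum_mono)
      (auto simp: abs_mult intro!: mult_left_mono abs_index_le_vec_norm_inf)
  also have "\<dots> = (\<Sum>j\<in>{..<n} - {i}. \<bar>A $$ (i, j)\<bar>) * vec_norm_inf v"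
    by (simp add: sum_distrib_right)
  also have "\<dots> \<le> (\<bar>A $$ (i, i)\<bar> - \<delta>) * vec_norm_inf v"
    using dom[OF i] vec_norm_inf_nonneg[of v] v n by (intro mult_right_mono) auto
  also have "\<dots> = \<bar>A $$ (i, i) * vec_index v i\<bar> - \<delta> * vec_norm_inf v"
    by (simp add: vi abs_mult algebra_simps)
  finally have "\<delta> * vec_norm_inf v \<le> \<bar>vec_index (A *\<^sub>v v) i\<bar>"
    using split by linarith
  also have "\<dots> \<le> vec_norm_inf (A *\<^sub>v v)"
    using A i by (intro abs_index_le_vec_norm_inf) auto
  finally show ?thesis .
qed

text \<open>The lower bound forces a trivial kernel, hence a nonzero determinant. Applied to images
  under \<open>B\<close>, the same bound controls the row sums of \<open>B\<close>, with no constant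
  depending on the dimension.\<close>

lemma expanding_matrix_inverse:
  fixes A :: "real Matrix.mat"
  assumes A: "A \<in> carrier_mat n n" and n: "n > 0" and \<delta>: "\<delta> > 0"
    and expand: "\<And>v. v \<in> carrier_vec n \<Longrightarrow> \<delta> * vec_norm_inf v \<le> vec_norm_inf (A *\<^sub>v v)"
  obtains B where "B \<in> carrier_mat n n" "A * B = 1\<^sub>m n" "B * A = 1\<^sub>m n"
    "mat_norm_inf B \<le> 1 / \<delta>"
proof -
  have "det A \<noteq> 0"
  proof
    assume "det A = 0"
    then obtain v where v: "v \<in> carrier_vec n" "v \<noteq> 0\<^sub>v n" "A *\<^sub>v v = 0\<^sub>v n"
      using det_0_iff_vec_prod_zero_field[OF A] by auto
    have "vec_norm_inf (0\<^sub>v n :: real Matrix.vec) \<le> 0"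
      using n by (subst vec_norm_inf_le_iff) auto
    then have "\<delta> * vec_norm_inf v \<le> 0"
      using expand[OF v(1)] v(3) by simp
    then have "vec_norm_inf v \<le> 0"
      using \<delta> by (simp add: mult_le_0_iff)
    then have "v = 0\<^sub>v n"
      using v(1) n by (intro eq_vecI) (auto simp: vec_norm_inf_le_iff)
    with v(2) show False ..
  qed
  then obtain B where B: "B \<in> carrier_mat n n" "A * B = 1\<^sub>m n" "B * A = 1\<^sub>m n"
    using det_non_zero_imp_unit[OF A] unfolding Units_def ring_mat_def by auto
  have "(\<Sum>j<n. \<bar>B $$ (i, j)\<bar>) \<le> 1 / \<delta>" if i: "i < n" for i
  proof -
    \<comment> \<open>The sign pattern of row \<open>i\<close> turns the absolute row sum into a
      single entry of the product of \<open>B\<close> with \<open>v\<close>, while the norm of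
      \<open>v\<close> stays at most 1.\<close>
    define v where "v = Matrix.vec n (\<lambda>j. sgn (B $$ (i, j)))"
    have v: "v \<in> carrier_vec n" by (simp add: v_def)
    have Bv: "B *\<^sub>v v \<in> carrier_vec n" using B(1) v by auto
    have "(\<Sum>j<n. \<bar>B $$ (i, j)\<bar>) = vec_index (B *\<^sub>v v) i"
      unfolding mult_mat_vec_index[OF B(1) v i] by (simp add: v_def abs_sgn)
    also have "\<dots> \<le> \<bar>vec_index (B *\<^sub>v v) i\<bar>" by (rule abs_ge_self)
    also have "\<dots> \<le> vec_norm_inf (B *\<^sub>v v)"
      using B(1) i by (intro abs_index_le_vec_norm_inf) simp
    finally have "\<delta> * (\<Sum>j<n. \<bar>B $$ (i, j)\<bar>) \<le> \<delta> * vec_norm_inf (B *\<^sub>v v)"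
      using \<delta> by simp
    also have "\<dots> \<le> vec_norm_inf (A *\<^sub>v (B *\<^sub>v v))"
      by (rule expand[OF Bv])
    also have "A *\<^sub>v (B *\<^sub>v v) = v"
      using A B v by (metis assoc_mult_mat_vec one_mult_mat_vec)
    also have "vec_norm_inf v \<le> 1"
      using n by (subst vec_norm_inf_le_iff) (auto simp: v_def abs_sgn_eq)
    finally show ?thesis using \<delta> by (simp add: field_simps)
  qed
  then have "mat_norm_inf B \<le> 1 / \<delta>"
    using B(1) n by (subst mat_norm_inf_le_iff) auto
  with B show ?thesis using that by blast
qed

section \<open>Rows of the scheme matrix\<close>

text \<open>The general \<open>\<phi>\<close> serves two purposes: products with a vector, and sums
  of absolute values. The condition \<open>\<phi> j 0 = 0\<close> removes all columns outside the
  stencil.\<close>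

lemma scheme_mat_row_sum:
  assumes N: "N \<ge> 3" and i: "i < N" and \<phi>: "\<And>j. \<phi> j 0 = 0"
  shows "(\<Sum>j<N. \<phi> j (scheme_mat a b g c N $$ (i, j))) =
    \<phi> i (coeff_C a b g c N i) + \<phi> ((i + N - 1) mod N) (coeff_L a b g N i)
      + \<phi> ((i + 1) mod N) (coeff_R a b g N i)"
proof -
  let ?l = "(i + N - 1) mod N" and ?r = "(i + 1) mod N"
  have l: "?l = (if i = 0 then N - 1 else i - 1)"
    using N i by (auto simp: mod_if)
  have r: "?r = (if i = N - 1 then 0 else i + 1)"
    using N i by (auto simp: mod_if)
  \<comment> \<open>This is where \<open>N \<ge> 3\<close> matters: for \<open>N = 2\<close> the
    left and right neighbours coincide.\<close>
  have ne: "?l \<noteq> i" "?r \<noteq> i" "?r \<noteq> ?l"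
    unfolding l r using N i by auto
  have lt: "?l < N" "?r < N" using N by auto
  have "(\<Sum>j<N. \<phi> j (scheme_mat a b g c N $$ (i, j))) =
      (\<Sum>j\<in>{i, ?l, ?r}. \<phi> j (scheme_mat a b g c N $$ (i, j)))"
    using i lt by (intro sum.mono_neutral_right) (auto simp: scheme_mat_def \<phi>)
  also have "\<dots> = \<phi> i (coeff_C a b g c N i) + \<phi> ?l (coeff_L a b g N i)
      + \<phi> ?r (coeff_R a b g N i)"
    using i lt ne by (auto simp: scheme_mat_def add_ac simp del: mod_less)
  finally show ?thesis .
qed

lemma scheme_mat_mult_vec_index:
  assumes "N \<ge> 3" "i < N" "v \<in> carrier_vec N"
  shows "vec_index (scheme_mat a b g c N *\<^sub>v v) i =
    coeff_L a b g N i * vec_index v ((i + N - 1) mod N) + coeff_C a b g c N i * vec_index v i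
      + coeff_R a b g N i * vec_index v ((i + 1) mod N)"
  using scheme_mat_row_sum[OF assms(1,2), of "\<lambda>j x. x * vec_index v j" a b g c] assms
  by (subst mult_mat_vec_index[of _ N N]) (auto simp: scheme_mat_def)

text \<open>By \<open>small\<close> both factors \<open>1 + s\<close> and \<open>1 - s\<close> are
  nonnegative, so the first-order terms cancel in the sum of the off-diagonal absolute values. That
  sum is \<open>2 * q\<close>, the diagonal is \<open>c + 2 * q\<close>, and the margin is exactly
  the value of \<open>c\<close>.\<close>

lemma scheme_mat_diag_dominant:
  assumes N: "N \<ge> 3" and i: "i < N" and h: "step a b N > 0"
    and g: "g (node a b N i) > 0" and c: "c (node a b N i) \<ge> \<delta>" "\<delta> \<ge> 0"
    and small: "\<bar>pderiv_on a b g (node a b N i) * step a b N / (4 * g (node a b N i))\<bar> \<le> 1"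
  shows "\<delta> + (\<Sum>j\<in>{..<N} - {i}. \<bar>scheme_mat a b g c N $$ (i, j)\<bar>)
    \<le> \<bar>scheme_mat a b g c N $$ (i, i)\<bar>"
proof -
  let ?q = "1 / (g (node a b N i) * (step a b N)\<^sup>2)"
  let ?s = "pderiv_on a b g (node a b N i) * step a b N / (4 * g (node a b N i))"
  have q: "?q > 0" using g h by simp
  have L: "coeff_L a b g N i = - ?q * (1 + ?s)" and R: "coeff_R a b g N i = - ?q * (1 - ?s)"
    and C: "coeff_C a b g c N i = c (node a b N i) + 2 * ?q"
    by (simp_all add: coeff_L_def coeff_R_def coeff_C_def Let_def)
  have s: "0 \<le> 1 + ?s" "0 \<le> 1 - ?s" using small by linarith+
  have absL: "\<bar>coeff_L a b g N i\<bar> = ?q * (1 + ?s)" and absR: "\<bar>coeff_R a b g N i\<bar> = ?q * (1 - ?s)"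
    unfolding L R abs_mult abs_minus_cancel using q s by (simp_all only: abs_of_pos abs_of_nonneg)
  have absC: "\<bar>coeff_C a b g c N i\<bar> = c (node a b N i) + 2 * ?q"
    unfolding C using q c by linarith
  have diag: "scheme_mat a b g c N $$ (i, i) = coeff_C a b g c N i"
    using i by (simp add: scheme_mat_def)
  have "(\<Sum>j<N. \<bar>scheme_mat a b g c N $$ (i, j)\<bar>) =
      \<bar>coeff_C a b g c N i\<bar> + ?q * (1 + ?s) + ?q * (1 - ?s)"
    using scheme_mat_row_sum[OF N i, of "\<lambda>j x. \<bar>x\<bar>" a b g c] absL absR by simp
  \<comment> \<open>Evaluating the same row sum a second time lets the diagonal term cancel.\<close>
  also have "(\<Sum>j<N. \<bar>scheme_mat a b g c N $$ (i, j)\<bar>) =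
      \<bar>coeff_C a b g c N i\<bar> + (\<Sum>j\<in>{..<N} - {i}. \<bar>scheme_mat a b g c N $$ (i, j)\<bar>)"
    using i diag by (subst sum.remove[of _ i]) auto
  finally have "(\<Sum>j\<in>{..<N} - {i}. \<bar>scheme_mat a b g c N $$ (i, j)\<bar>) = 2 * ?q"
    by (simp add: algebra_simps)
  then show ?thesis unfolding diag absC using c by simp
qed

section \<open>Truncation error\<close>

text \<open>The top derivative is continuous on a compact interval, so one bound on it serves all
  pairs \<open>x\<close>, \<open>y\<close>, endpoints included.\<close>

lemma Ck_on_Taylor:
  fixes u :: "real \<Rightarrow> real"
  assumes "Ck_on (Suc n) a b u"
  obtains M where "\<And>x y. x \<in> {a..b} \<Longrightarrow> y \<in> {a..b} \<Longrightarrow>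
    \<bar>u y - (\<Sum>i\<le>n. iter_pderiv_on a b i u x * (y - x) ^ i / fact i)\<bar> \<le> M * \<bar>y - x\<bar> ^ Suc n"
proof -
  have "bounded (iter_pderiv_on a b (Suc n) u ` {a..b})"
    using assms unfolding Ck_on_def
    by (intro compact_imp_bounded compact_continuous_image) auto
  then obtain M where M: "\<And>x. x \<in> {a..b} \<Longrightarrow> \<bar>iter_pderiv_on a b (Suc n) u x\<bar> \<le> M"
    unfolding bounded_iff by (metis imageI real_norm_def)
  have deriv: "(iter_pderiv_on a b i u has_field_derivative iter_pderiv_on a b (Suc i) u x)
      (at x within {a..b})" if "x \<in> {a..b}" "i \<le> n" for i x
  proof -
    have "iter_pderiv_on a b i u differentiable (at x within {a..b})"
      using assms that unfolding Ck_on_def differentiable_on_def by auto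
    then show ?thesis
      unfolding has_real_derivative_iff_has_vector_derivative vector_derivative_works
      by (simp add: iter_pderiv_on_def pderiv_on_def)
  qed
  show ?thesis
  proof (rule that)
    fix x y assume xy: "x \<in> {a..b}" "y \<in> {a..b}"
    show "\<bar>u y - (\<Sum>i\<le>n. iter_pderiv_on a b i u x * (y - x) ^ i / fact i)\<bar>
        \<le> M / fact n * \<bar>y - x\<bar> ^ Suc n"
      using field_Taylor[of "{a..b}" n "\<lambda>i. iter_pderiv_on a b i u" M x y] deriv M xy
      by (simp add: iter_pderiv_on_def)
  qed
qed

text \<open>An exact identity for arbitrary \<open>um\<close> and \<open>up\<close>. Inserting the
  cubic Taylor polynomials, the terms in \<open>u0\<close>, \<open>d1\<close> and \<open>d2\<close>
  reproduce the differential operator. The \<open>d3\<close> terms cancel except for the asymmetry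
  \<open>s\<close> of the weights, which leaves the first term on the right; the rest is the
  weighted Taylor remainders.\<close>

lemma truncation_error_identity:
  fixes h G G' :: real
  assumes "h \<noteq> 0" "G \<noteq> 0"
  shows "- (1 / (G * h\<^sup>2)) * (1 + G' * h / (4 * G)) * um + (c + 2 / (G * h\<^sup>2)) * u0
      + - (1 / (G * h\<^sup>2)) * (1 - G' * h / (4 * G)) * up
      - (- (1 / G * d2 - 1 / (2 * G\<^sup>2) * G' * d1) + c * u0) =
    G' * d3 * h\<^sup>2 / (12 * G\<^sup>2)
      - ((1 + G' * h / (4 * G)) * (um - (u0 - d1 * h + d2 * h\<^sup>2 / 2 - d3 * h ^ 3 / 6))
       + (1 - G' * h / (4 * G)) * (up - (u0 + d1 * h + d2 * h\<^sup>2 / 2 + d3 * h ^ 3 / 6)))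
        / (G * h\<^sup>2)"
proof -
  \<comment> \<open>In \<open>q\<close> and \<open>s\<close> the identity has only numeral
    denominators; \<open>powers\<close> absorbs the divisions by \<open>G\<close>.\<close>
  define q s where "q = 1 / (G * h\<^sup>2)" and "s = G' * h / (4 * G)"
  have div: "x / (G * h\<^sup>2) = q * x" for x
    by (simp add: q_def)
  have powers: "1 / G * d2 = q * (d2 * h\<^sup>2)" "1 / (2 * G\<^sup>2) * G' * d1 = 2 * (q * s * (d1 * h))"
    "G' * d3 * h\<^sup>2 / (12 * G\<^sup>2) = q * s * (d3 * h ^ 3) / 3"
    using assms by (simp_all add: q_def s_def field_simps eval_nat_numeral)
  have "- q * (1 + s) * um + (c + q * 2) * u0 + - q * (1 - s) * up
      - (- (q * (d2 * h\<^sup>2) - 2 * (q * s * (d1 * h))) + c * u0) =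
    q * s * (d3 * h ^ 3) / 3 - q *
      ((1 + s) * (um - (u0 - d1 * h + d2 * h\<^sup>2 / 2 - d3 * h ^ 3 / 6))
       + (1 - s) * (up - (u0 + d1 * h + d2 * h\<^sup>2 / 2 + d3 * h ^ 3 / 6)))"
    by (simp add: field_simps)
  then show ?thesis
    unfolding q_def[symmetric] s_def[symmetric] unfolding div powers .
qed

text \<open>The weights have modulus at most 2, so the two remainders contribute at most
  \<open>4 * E * h ^ 4\<close>; dividing by \<open>G * h\<^sup>2\<close>, which is at least
  \<open>m * h\<^sup>2\<close>, leaves order two.\<close>

lemma truncation_error_bound:
  fixes h G G' :: real
  assumes h: "h > 0" and G: "m \<le> G" "m > 0" and s: "\<bar>G' * h / (4 * G)\<bar> \<le> 1"
    and bounds: "\<bar>G'\<bar> \<le> B" "\<bar>d3\<bar> \<le> D"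
    and um: "\<bar>um - (u0 - d1 * h + d2 * h\<^sup>2 / 2 - d3 * h ^ 3 / 6)\<bar> \<le> E * h ^ 4"
    and up: "\<bar>up - (u0 + d1 * h + d2 * h\<^sup>2 / 2 + d3 * h ^ 3 / 6)\<bar> \<le> E * h ^ 4"
  shows "\<bar>- (1 / (G * h\<^sup>2)) * (1 + G' * h / (4 * G)) * um + (c + 2 / (G * h\<^sup>2)) * u0
      + - (1 / (G * h\<^sup>2)) * (1 - G' * h / (4 * G)) * up
      - (- (1 / G * d2 - 1 / (2 * G\<^sup>2) * G' * d1) + c * u0)\<bar>
    \<le> (B * D / (12 * m\<^sup>2) + 4 * E / m) * h\<^sup>2"
proof -
  let ?s = "G' * h / (4 * G)"
  let ?rm = "um - (u0 - d1 * h + d2 * h\<^sup>2 / 2 - d3 * h ^ 3 / 6)"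
  let ?rp = "up - (u0 + d1 * h + d2 * h\<^sup>2 / 2 + d3 * h ^ 3 / 6)"
  have E: "E * h ^ 4 \<ge> 0" using um by linarith
  then have E0: "E \<ge> 0" using h by (simp add: zero_le_mult_iff)
  have "\<bar>1 + ?s\<bar> \<le> 2" "\<bar>1 - ?s\<bar> \<le> 2"
    using s by linarith+
  then have "\<bar>(1 + ?s) * ?rm\<bar> \<le> 2 * (E * h ^ 4)" "\<bar>(1 - ?s) * ?rp\<bar> \<le> 2 * (E * h ^ 4)"
    unfolding abs_mult using um up by (auto intro!: mult_mono simp del: abs_divide)
  then have "\<bar>(1 + ?s) * ?rm + (1 - ?s) * ?rp\<bar> \<le> 2 * (E * h ^ 4) + 2 * (E * h ^ 4)"
    by (rule order_trans[OF abs_triangle_ineq add_mono])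
  then have "\<bar>(1 + ?s) * ?rm + (1 - ?s) * ?rp\<bar> \<le> 4 * E * h ^ 4"
    by simp
  then have "\<bar>(1 + ?s) * ?rm + (1 - ?s) * ?rp\<bar> / (G * h\<^sup>2) \<le> 4 * E * h ^ 4 / (m * h\<^sup>2)"
    using h G E0 by (intro frac_le mult_right_mono) auto
  also have "\<dots> = 4 * E / m * h\<^sup>2"
    using h by (simp add: field_simps eval_nat_numeral)
  finally have 1: "\<bar>((1 + ?s) * ?rm + (1 - ?s) * ?rp) / (G * h\<^sup>2)\<bar> \<le> 4 * E / m * h\<^sup>2"
    using h G by (simp add: abs_mult)
  have "\<bar>G'\<bar> * \<bar>d3\<bar> * h\<^sup>2 / (12 * G\<^sup>2) \<le> B * D * h\<^sup>2 / (12 * m\<^sup>2)"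
    using bounds G by (intro frac_le mult_right_mono mult_mono mult_left_mono power_mono) auto
  then have 2: "\<bar>G' * d3 * h\<^sup>2 / (12 * G\<^sup>2)\<bar> \<le> B * D / (12 * m\<^sup>2) * h\<^sup>2"
    by (simp add: abs_mult)
  show ?thesis
    unfolding truncation_error_identity[OF less_imp_neq[OF h, symmetric]
        less_imp_neq[OF less_le_trans[OF G(2,1)], symmetric], where ?d3.0 = d3]
    by (rule order_trans[OF abs_triangle_ineq4 add_mono[OF 2 1, folded distrib_right]])
qed

lemma node_in_interval:
  assumes "a \<le> b" "i \<le> N"
  shows "node a b N i \<in> {a..b}"
proof (cases "N = 0")
  \<comment> \<open>Here \<open>step a b N\<close> is 0 by the convention on division by zero, and
    the identity used in the other case fails.\<close>
  case True
  then show ?thesis using assms by (simp add: node_def step_def)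
next
  case False
  have "real i * step a b N \<le> real N * step a b N"
    using assms by (intro mult_right_mono) (auto simp: step_def)
  also have "\<dots> = b - a" using False by (simp add: step_def)
  finally show ?thesis using assms by (simp add: node_def step_def)
qed

text \<open>A single \<open>E\<close> serves all nodes and all \<open>N\<close>, as a bound uniform
  in the step size requires. Index \<open>N\<close> is not an unknown of the scheme; periodicity
  identifies it with index 0.\<close>

lemma periodic_Taylor_neighbours:
  fixes u :: "real \<Rightarrow> real"
  assumes "a < b" and u: "periodic_Ck 4 a b u"
  defines "d \<equiv> \<lambda>N i r. iter_pderiv_on a b r u (node a b N i)"
  obtains E where
    "\<And>N i. i < N \<Longrightarrow>
      \<bar>u (node a b N ((i + N - 1) mod N)) - (u (node a b N i) - d N i 1 * step a b N
        + d N i 2 * (step a b N)\<^sup>2 / 2 - d N i 3 * step a b N ^ 3 / 6)\<bar> \<le> E * step a b N ^ 4"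
    "\<And>N i. i < N \<Longrightarrow>
      \<bar>u (node a b N ((i + 1) mod N)) - (u (node a b N i) + d N i 1 * step a b N
        + d N i 2 * (step a b N)\<^sup>2 / 2 + d N i 3 * step a b N ^ 3 / 6)\<bar> \<le> E * step a b N ^ 4"
proof -
  have "Ck_on (Suc 3) a b u" using u by (simp add: periodic_Ck_def)
  then obtain E where E: "\<And>x y. x \<in> {a..b} \<Longrightarrow> y \<in> {a..b} \<Longrightarrow>
      \<bar>u y - (\<Sum>i\<le>3. iter_pderiv_on a b i u x * (y - x) ^ i / fact i)\<bar> \<le> E * \<bar>y - x\<bar> ^ Suc 3"
    by (rule Ck_on_Taylor) blast
  have periodic: "iter_pderiv_on a b r u a = iter_pderiv_on a b r u b" if "r \<le> 4" for r
    using u that by (simp add: periodic_Ck_def)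
  have u_eq: "iter_pderiv_on a b 0 u = u" by (simp add: iter_pderiv_on_def)
  \<comment> \<open>The even power of the remainder absorbs the absolute value, so the sign of
    \<open>h\<close> does not enter.\<close>
  have left: "\<bar>u (x - h) - (u x - iter_pderiv_on a b 1 u x * h + iter_pderiv_on a b 2 u x * h\<^sup>2 / 2
      - iter_pderiv_on a b 3 u x * h ^ 3 / 6)\<bar> \<le> E * h ^ 4"
    if "x \<in> {a..b}" "x - h \<in> {a..b}" for x h
    using E[OF that] by (simp add: eval_nat_numeral u_eq fact_numeral algebra_simps)
  have right: "\<bar>u (x + h) - (u x + iter_pderiv_on a b 1 u x * h + iter_pderiv_on a b 2 u x * h\<^sup>2 / 2
      + iter_pderiv_on a b 3 u x * h ^ 3 / 6)\<bar> \<le> E * h ^ 4"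
    if "x \<in> {a..b}" "x + h \<in> {a..b}" for x h
    using E[OF that] by (simp add: eval_nat_numeral u_eq fact_numeral algebra_simps)
  show ?thesis
  proof (rule that[of E])
    fix N i :: nat assume i: "i < N"
    let ?h = "step a b N"
    have endpoints: "node a b N 0 = a" "node a b N N = b"
      using i by (auto simp: node_def step_def)
    have wrap: "iter_pderiv_on a b r u (node a b N 0) = iter_pderiv_on a b r u (node a b N N)"
      if "r \<le> 4" for r
      using periodic[OF that] endpoints by simp
    have node_Suc: "node a b N (Suc j) = node a b N j + ?h" for j
      by (simp add: node_def algebra_simps)
    have mem: "node a b N j \<in> {a..b}" if "j \<le> N" for j
      using node_in_interval assms(1) that by simp
    show "\<bar>u (node a b N ((i + N - 1) mod N)) - (u (node a b N i) - d N i 1 * ?h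
        + d N i 2 * ?h\<^sup>2 / 2 - d N i 3 * ?h ^ 3 / 6)\<bar> \<le> E * ?h ^ 4"
    proof -
      \<comment> \<open>\<open>k\<close> is the index of the expansion centre: \<open>N\<close> if
        \<open>i = 0\<close>, and \<open>i\<close> otherwise. The left neighbour is then always one
        step below it, without wrapping.\<close>
      obtain j k where j: "(i + N - 1) mod N = j" "k = Suc j" "k \<le> N"
        and k: "\<forall>r\<le>4. d N i r = iter_pderiv_on a b r u (node a b N k)"
      proof (cases i)
        case 0
        show ?thesis
          by (rule that[of "N - 1" N]) (use 0 i wrap in \<open>auto simp: d_def\<close>)
      next
        case (Suc j)
        show ?thesis
          by (rule that[of j i]) (use Suc i in \<open>auto simp: d_def\<close>)
      qed
      have "u (node a b N i) = u (node a b N k)"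
        using k[rule_format, of 0] by (simp add: d_def u_eq)
      moreover have "node a b N j = node a b N k - ?h"
        using j node_Suc by simp
      ultimately show ?thesis
        using left[of "node a b N k" ?h] mem[of j] mem[of k] j k by simp
    qed
    show "\<bar>u (node a b N ((i + 1) mod N)) - (u (node a b N i) + d N i 1 * ?h
        + d N i 2 * ?h\<^sup>2 / 2 + d N i 3 * ?h ^ 3 / 6)\<bar> \<le> E * ?h ^ 4"
    proof -
      \<comment> \<open>On this side only the value of \<open>u\<close> wraps; the centre stays at
        index \<open>i\<close>.\<close>
      have "u (node a b N ((i + 1) mod N)) = u (node a b N (Suc i))"
        using i wrap[of 0] by (cases "Suc i = N") (auto simp: u_eq)
      then show ?thesis
        using right[of "node a b N i" ?h] mem[of i] mem[of "Suc i"] i node_Suc[of i]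
        by (simp add: d_def)
    qed
  qed
qed

lemma step_tendsto_0: "step a b \<longlonglongrightarrow> 0"
  unfolding step_def by real_asymp

section \<open>Convergence of the scheme\<close>

lemma scheme_mat_carrier [simp]: "scheme_mat a b g c N \<in> carrier_mat N N"
  by (simp add: scheme_mat_def)

lemma sample_vec_carrier [simp]: "sample_vec a b h N \<in> carrier_vec N"
  by (simp add: sample_vec_def)

text \<open>The error \<open>v N - U N\<close> is mapped by \<open>A N\<close> to the consistency
  residual, so \<open>expand\<close> bounds it by the residual divided by \<open>\<delta>\<close>.
  The resulting constant \<open>K / \<delta>\<close> is fixed before \<open>U\<close>, as
  \<open>scheme_second_order\<close> demands.\<close>

lemma stable_consistent_imp_second_order:
  fixes A :: "nat \<Rightarrow> real Matrix.mat"
  assumes A: "\<And>N. A N \<in> carrier_mat N N" and F: "\<And>N. F N \<in> carrier_vec N"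
    and v: "\<And>N. v N \<in> carrier_vec N" and \<delta>: "\<delta> > 0"
    and expand: "\<forall>\<^sub>F N in sequentially. \<forall>w\<in>carrier_vec N.
      \<delta> * vec_norm_inf w \<le> vec_norm_inf (A N *\<^sub>v w)"
    and consistent: "\<forall>\<^sub>F N in sequentially. vec_norm_inf (A N *\<^sub>v v N - F N) \<le> K * (h N)\<^sup>2"
  shows "scheme_stable A" "scheme_second_order h A F v"
proof -
  have inverse: "\<forall>\<^sub>F N in sequentially. \<exists>B\<in>carrier_mat N N.
      A N * B = 1\<^sub>m N \<and> B * A N = 1\<^sub>m N \<and> mat_norm_inf B \<le> 1 / \<delta>"
    using expand eventually_gt_at_top[of 0]
  proof eventually_elim
    case (elim N)
    show ?case
      by (rule expanding_matrix_inverse[OF A elim(2) \<delta>]) (use elim in auto)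
  qed
  then have "\<forall>\<^sub>F N in sequentially. \<exists>B\<in>carrier_mat N N.
      inverts_mat (A N) B \<and> inverts_mat B (A N) \<and> mat_norm_inf B \<le> 1 / \<delta>"
  proof eventually_elim
    case (elim N)
    then obtain B where "B \<in> carrier_mat N N" "A N * B = 1\<^sub>m N" "B * A N = 1\<^sub>m N"
      "mat_norm_inf B \<le> 1 / \<delta>" by blast
    then show ?case
      using A[of N] by (intro bexI[of _ B]) (auto simp: inverts_mat_def)
  qed
  then show "scheme_stable A" unfolding scheme_stable_def by blast
  have "\<forall>\<^sub>F N in sequentially. \<exists>U. U \<in> carrier_vec N \<and> A N *\<^sub>v U = F N"
    using inverse
  proof eventually_elim
    case (elim N)
    then obtain B where B: "B \<in> carrier_mat N N" "A N * B = 1\<^sub>m N" by blast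
    then have "A N *\<^sub>v (B *\<^sub>v F N) = F N"
      using A F by (metis assoc_mult_mat_vec one_mult_mat_vec)
    moreover have "B *\<^sub>v F N \<in> carrier_vec N"
      using B(1) F by (rule mult_mat_vec_carrier)
    ultimately show ?case by blast
  qed
  \<comment> \<open>For the finitely many \<open>N\<close> where solvability is not known the chosen
    value is arbitrary, which \<open>scheme_solution\<close> permits.\<close>
  then have "scheme_solution A F (\<lambda>N. SOME U. U \<in> carrier_vec N \<and> A N *\<^sub>v U = F N)"
    unfolding scheme_solution_def by eventually_elim (rule someI_ex)
  moreover have "\<forall>\<^sub>F N in sequentially. vec_norm_inf (v N - U N) \<le> K / \<delta> * (h N)\<^sup>2"
    if "scheme_solution A F U" for U
    using that[unfolded scheme_solution_def] expand consistent
  proof eventually_elim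
    case (elim N)
    have "A N *\<^sub>v (v N - U N) = A N *\<^sub>v v N - F N"
      using mult_minus_distrib_mat_vec[OF A v, of "U N"] elim by simp
    then have "\<delta> * vec_norm_inf (v N - U N) \<le> K * (h N)\<^sup>2"
      using elim v[of N] by (metis minus_carrier_vec order_trans)
    then show ?case using \<delta> by (simp add: field_simps)
  qed
  ultimately show "scheme_second_order h A F v"
    unfolding scheme_second_order_def by blast
qed

lemma second_order_imp_convergent:
  assumes so: "scheme_second_order h A F v" and h: "h \<longlonglongrightarrow> 0" and v: "\<And>N. v N \<in> carrier_vec N"
  shows "scheme_convergent A F v"
  unfolding scheme_convergent_def
proof (intro conjI allI impI)
  show "\<exists>U. scheme_solution A F U" using so by (simp add: scheme_second_order_def)
  fix U assume U: "scheme_solution A F U"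
  then obtain K where K: "\<forall>\<^sub>F N in sequentially. vec_norm_inf (v N - U N) \<le> K * (h N)\<^sup>2"
    using so unfolding scheme_second_order_def by blast
  \<comment> \<open>Only eventual: at \<open>N = 0\<close> the norm is \<open>Max\<close> of the
    empty set.\<close>
  have "\<forall>\<^sub>F N in sequentially. 0 \<le> vec_norm_inf (v N - U N)"
    using U[unfolded scheme_solution_def] eventually_gt_at_top[of 0]
    by eventually_elim (rule vec_norm_inf_nonneg, auto)
  moreover have "(\<lambda>N. K * (h N)\<^sup>2) \<longlonglongrightarrow> 0"
    using tendsto_mult_right_zero[OF tendsto_null_power[OF h, of 2], of K] by simp
  ultimately show "(\<lambda>N. vec_norm_inf (v N - U N)) \<longlonglongrightarrow> 0"
    by (rule tendsto_sandwich[OF _ K tendsto_const])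
qed

text \<open>A \<open>C^1\<close> parametrization makes \<open>g\<close> continuous, but the equation
  and the scheme also contain its derivative; hence \<open>g_diff\<close>. The hypothesis
  \<open>g'_bounded\<close> makes the restriction on the step size and the error constant uniform
  over the nodes.\<close>

theorem theorem2p8:
  fixes \<Omega> :: "(real ^ 'n) set" and X :: "real \<Rightarrow> real ^ 'n"
    and a b :: real and g u c f :: "real \<Rightarrow> real"
  assumes curve: "real_algebraic_curve \<Omega>"
    and param: "closed_Ck_parametrization 1 a b X \<Omega>"
    and regular: "\<forall>t\<in>{a..b}. pderiv_on a b X t \<noteq> 0"
    and g_def: "g = metric_coeff a b X"
    and g_diff: "g differentiable_on {a..b}"
    and g'_bounded: "bounded (pderiv_on a b g ` {a..b})"
    and c_periodic: "c a = c b"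
    and f_periodic: "f a = f b"
    and u_C4: "periodic_Ck 4 a b u"
    and pde: "\<forall>t\<in>{a..b}. - laplace_beltrami a b g u t + c t * u t = f t"
    and c_pos: "\<exists>\<delta>>0. \<forall>t\<in>{a..b}. c t > \<delta>"
  shows "scheme_convergent (scheme_mat a b g c) (sample_vec a b f) (sample_vec a b u) \<and>
         scheme_stable (scheme_mat a b g c) \<and>
         scheme_second_order (step a b) (scheme_mat a b g c) (sample_vec a b f) (sample_vec a b u)"
proof -
  let ?A = "scheme_mat a b g c" and ?F = "sample_vec a b f" and ?u = "sample_vec a b u"
  let ?h = "step a b"
  have ab: "a < b" using param by (simp add: closed_Ck_parametrization_def)
  obtain \<delta> where \<delta>: "\<delta> > 0" "\<And>t. t \<in> {a..b} \<Longrightarrow> c t > \<delta>" using c_pos by auto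
  obtain B where B: "\<And>t. t \<in> {a..b} \<Longrightarrow> \<bar>pderiv_on a b g t\<bar> \<le> B"
    using g'_bounded unfolding bounded_iff by (metis imageI real_norm_def)
  \<comment> \<open>Regularity gives \<open>g > 0\<close> pointwise; compactness makes the lower
    bound uniform.\<close>
  obtain m where m: "m > 0" "\<And>t. t \<in> {a..b} \<Longrightarrow> m \<le> g t"
  proof -
    obtain s where s: "s \<in> {a..b}" "\<And>t. t \<in> {a..b} \<Longrightarrow> g s \<le> g t"
      using continuous_attains_inf[of "{a..b}" g] differentiable_imp_continuous_on[OF g_diff] ab
      by auto
    moreover have "g s > 0" using regular s(1) by (simp add: g_def metric_coeff_def)
    ultimately show ?thesis using that by blast
  qed
  obtain D where D: "\<And>t. t \<in> {a..b} \<Longrightarrow> \<bar>iter_pderiv_on a b 3 u t\<bar> \<le> D"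
  proof -
    have "continuous_on {a..b} (iter_pderiv_on a b 3 u)"
      using u_C4 by (intro differentiable_imp_continuous_on) (auto simp: periodic_Ck_def Ck_on_def)
    then have "bounded (iter_pderiv_on a b 3 u ` {a..b})"
      by (intro compact_imp_bounded compact_continuous_image) auto
    then show ?thesis using that unfolding bounded_iff by (metis imageI real_norm_def)
  qed
  obtain E where E:
    "\<And>N i. i < N \<Longrightarrow> \<bar>u (node a b N ((i + N - 1) mod N)) - (u (node a b N i)
        - iter_pderiv_on a b 1 u (node a b N i) * ?h N
        + iter_pderiv_on a b 2 u (node a b N i) * (?h N)\<^sup>2 / 2
        - iter_pderiv_on a b 3 u (node a b N i) * ?h N ^ 3 / 6)\<bar> \<le> E * ?h N ^ 4"
    "\<And>N i. i < N \<Longrightarrow> \<bar>u (node a b N ((i + 1) mod N)) - (u (node a b N i)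
        + iter_pderiv_on a b 1 u (node a b N i) * ?h N
        + iter_pderiv_on a b 2 u (node a b N i) * (?h N)\<^sup>2 / 2
        + iter_pderiv_on a b 3 u (node a b N i) * ?h N ^ 3 / 6)\<bar> \<le> E * ?h N ^ 4"
    using periodic_Taylor_neighbours[OF ab u_C4] by blast
  define K where "K = B * D / (12 * m\<^sup>2) + 4 * E / m"
  have "(\<lambda>N. B * ?h N) \<longlonglongrightarrow> 0"
    using tendsto_mult_right_zero[OF step_tendsto_0] by blast
  \<comment> \<open>The threshold \<open>4 * m\<close> is what makes the asymmetry of the weights at
    most 1 at every point of the interval.\<close>
  then have "\<forall>\<^sub>F N in sequentially. B * ?h N < 4 * m"
    using m(1) by (intro order_tendstoD) auto
  then have fine: "\<forall>\<^sub>F N in sequentially. N \<ge> 3 \<and> ?h N > 0 \<and>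
      (\<forall>t\<in>{a..b}. \<bar>pderiv_on a b g t * ?h N / (4 * g t)\<bar> \<le> 1)"
    using eventually_ge_at_top[of 3]
  proof eventually_elim
    case (elim N)
    have h: "?h N > 0" using ab elim by (simp add: step_def)
    have "\<bar>pderiv_on a b g t * ?h N / (4 * g t)\<bar> \<le> 1" if t: "t \<in> {a..b}" for t
    proof -
      have "\<bar>pderiv_on a b g t\<bar> * ?h N \<le> B * ?h N"
        using B[OF t] h by (intro mult_right_mono) auto
      also have "\<dots> \<le> 4 * g t" using elim m(2)[OF t] by simp
      finally show ?thesis using m(1) m(2)[OF t] h by (simp add: abs_mult)
    qed
    with h elim show ?case by blast
  qed
  have expand: "\<forall>\<^sub>F N in sequentially. \<forall>w\<in>carrier_vec N.
      \<delta> * vec_norm_inf w \<le> vec_norm_inf (?A N *\<^sub>v w)"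
    using fine
  proof eventually_elim
    case (elim N)
    have "\<delta> + (\<Sum>j\<in>{..<N} - {i}. \<bar>?A N $$ (i, j)\<bar>) \<le> \<bar>?A N $$ (i, i)\<bar>" if "i < N" for i
    proof -
      have t: "node a b N i \<in> {a..b}" using node_in_interval ab that by simp
      have small: "\<bar>pderiv_on a b g (node a b N i) * ?h N / (4 * g (node a b N i))\<bar> \<le> 1"
        using elim t by blast
      show ?thesis
        using elim that \<delta>(1) \<delta>(2)[OF t] m(1) m(2)[OF t]
        by (intro scheme_mat_diag_dominant small) auto
    qed
    then show ?case using elim by (auto intro!: diag_dominant_vec_norm_le[of _ N])
  qed
  have consistent: "\<forall>\<^sub>F N in sequentially. vec_norm_inf (?A N *\<^sub>v ?u N - ?F N) \<le> K * (?h N)\<^sup>2"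
    using fine
  proof eventually_elim
    case (elim N)
    have "\<bar>vec_index (?A N *\<^sub>v ?u N - ?F N) i\<bar> \<le> K * (?h N)\<^sup>2" if i: "i < N" for i
    proof -
      let ?t = "node a b N i"
      let ?um = "u (node a b N ((i + N - 1) mod N))" and ?up = "u (node a b N ((i + 1) mod N))"
      have t: "?t \<in> {a..b}" using node_in_interval ab i by simp
      have residual: "vec_index (?A N *\<^sub>v ?u N - ?F N) i =
          coeff_L a b g N i * ?um + coeff_C a b g c N i * u ?t + coeff_R a b g N i * ?up - f ?t"
        using i elim scheme_mat_mult_vec_index[of N i "?u N" a b g c]
        by (simp add: sample_vec_def)
      \<comment> \<open>The differential equation eliminates \<open>f\<close>, so the residual takes
        the form estimated in \<open>truncation_error_bound\<close>.\<close>
      have f: "f ?t = - (1 / g ?t * iter_pderiv_on a b 2 u ?t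
          - 1 / (2 * (g ?t)\<^sup>2) * pderiv_on a b g ?t * iter_pderiv_on a b 1 u ?t) + c ?t * u ?t"
        using pde t by (simp add: laplace_beltrami_def iter_pderiv_on_def)
      show ?thesis
        unfolding residual f coeff_L_def coeff_C_def coeff_R_def Let_def K_def
      proof (rule truncation_error_bound)
        show "\<bar>pderiv_on a b g ?t * ?h N / (4 * g ?t)\<bar> \<le> 1" using elim t by blast
      qed (use elim t m B D E[OF i] in blast)+
    qed
    then show ?case using elim by (subst vec_norm_inf_le_iff) (auto simp: sample_vec_def)
  qed
  have "scheme_stable ?A" and so: "scheme_second_order ?h ?A ?F ?u"
    using stable_consistent_imp_second_order[of ?A ?F ?u \<delta> K ?h] \<delta>(1) expand consistent by auto
  moreover have "scheme_convergent ?A ?F ?u"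
    using second_order_imp_convergent[OF so step_tendsto_0] by simp
  ultimately show ?thesis by blast
qed

end
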